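(* Let $A:[0,1]\to\mathbb{R}^{n\times n}$ be a Riemann integrable matrix function with entries $a_{ij}(t)$. If there exist $\delta>0$ and totally nonnegative matrices $G=(g_{ij})$ and $H=(h_{ij})$ in $\mathbb{R}^{n\times n}$ such that $$\delta+(-1)^{i+j}g_{ij}\le(-1)^{i+j}a_{ij}(t)\le-\delta+(-1)^{i+j}h_{ij}$$ for all $i,j\in\{1,\dots,n\}$ and all $t\in[0,1]$, then the matrix $\bar A:=\int_0^1A(t)\,\mathrm{d}t$ is totally positive.
   Context: A matrix is totally positive if all its minors (of all orders) are positive, and totally nonnegative if all its minors are nonnegative. Integrability and integrals of matrix functions are entrywise. *)

theory Defs
  imports
    "HOL-Analysis.Henstock_Kurzweil_Integration"
    "Jordan_Normal_Form.Determinant"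
    "Jordan_Normal_Form.DL_Submatrix"
begin

definition totally_positive :: "real mat \<Rightarrow> bool" where
  "totally_positive A \<longleftrightarrow>
     (\<forall>I J. I \<noteq> {} \<and> I \<subseteq> {..<dim_row A} \<and> J \<subseteq> {..<dim_col A} \<and> card I = card J
        \<longrightarrow> 0 < Determinant.det (submatrix A I J))"

definition totally_nonnegative :: "real mat \<Rightarrow> bool" where
  "totally_nonnegative A \<longleftrightarrow>
     (\<forall>I J. I \<noteq> {} \<and> I \<subseteq> {..<dim_row A} \<and> J \<subseteq> {..<dim_col A} \<and> card I = card J
        \<longrightarrow> 0 \<le> Determinant.det (submatrix A I J))"

text \<open>
  The library integral is the gauge integral, which integrates more functions than the
  Riemann integral. The Riemann integral is the limit of the same tagged sums, with the gauge
  replaced by a uniform bound on the mesh.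
\<close>

definition has_riemann_integral :: "(real \<Rightarrow> real) \<Rightarrow> real \<Rightarrow> real \<Rightarrow> real \<Rightarrow> bool" where
  "has_riemann_integral f y a b \<longleftrightarrow>
     (\<forall>e>0. \<exists>d>0. \<forall>p. p tagged_division_of {a..b} \<and> (\<forall>(x, K)\<in>p. diameter K < d)
        \<longrightarrow> \<bar>(\<Sum>(x, K)\<in>p. Henstock_Kurzweil_Integration.content K * f x) - y\<bar> < e)"

definition riemann_integrable :: "(real \<Rightarrow> real) \<Rightarrow> real \<Rightarrow> real \<Rightarrow> bool" where
  "riemann_integrable f a b \<longleftrightarrow> (\<exists>y. has_riemann_integral f y a b)"

definition riemann_integral :: "(real \<Rightarrow> real) \<Rightarrow> real \<Rightarrow> real \<Rightarrow> real" where
  "riemann_integral f a b = (THE y. has_riemann_integral f y a b)"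

lemma has_riemann_integral_imp_has_integral:
  assumes "has_riemann_integral f y a b"
  shows "(f has_integral y) {a..b}"
  unfolding has_integral_real
proof (intro allI impI)
  fix e :: real assume "e > 0"
  then obtain d where d: "d > 0"
    and *: "\<And>p. p tagged_division_of {a..b} \<Longrightarrow> \<forall>(x, K)\<in>p. diameter K < d
            \<Longrightarrow> \<bar>(\<Sum>(x, K)\<in>p. Henstock_Kurzweil_Integration.content K * f x) - y\<bar> < e"
    using assms unfolding has_riemann_integral_def by blast
  have small: "diameter K < d" if "K \<subseteq> ball x (d/3)" for x :: real and K
  proof -
    have "diameter K \<le> 2 * d / 3"
    proof (rule diameter_le)
      show "K \<noteq> {} \<or> 0 \<le> 2 * d / 3" using d by simp
      fix u v assume "u \<in> K" "v \<in> K"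
      then have "u \<in> ball x (d/3)" "v \<in> ball x (d/3)" using that by auto
      then show "norm (u - v) \<le> 2 * d / 3"
        unfolding mem_ball dist_real_def real_norm_def by linarith
    qed
    with d show ?thesis by linarith
  qed
  have mesh: "\<forall>(x, K)\<in>p. diameter K < d" if "(\<lambda>x. ball x (d/3)) fine p" for p :: "(real \<times> real set) set"
  proof (clarify)
    fix x K assume "(x, K) \<in> p"
    with that have "K \<subseteq> ball x (d/3)" by (rule fineD)
    then show "diameter K < d" by (rule small)
  qed
  have "\<forall>p. p tagged_division_of {a..b} \<and> (\<lambda>x. ball x (d/3)) fine p
      \<longrightarrow> norm ((\<Sum>(x, K)\<in>p. Henstock_Kurzweil_Integration.content K *\<^sub>R f x) - y) < e"
  proof (intro allI impI, elim conjE)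
    fix p :: "(real \<times> real set) set"
    assume "p tagged_division_of {a..b}" "(\<lambda>x. ball x (d/3)) fine p"
    then have "\<forall>(x, K)\<in>p. diameter K < d" using mesh by simp
    from *[OF \<open>p tagged_division_of {a..b}\<close> this]
    show "norm ((\<Sum>(x, K)\<in>p. Henstock_Kurzweil_Integration.content K *\<^sub>R f x) - y) < e"
      by simp
  qed
  moreover have "gauge (\<lambda>x::real. ball x (d/3))" using d by (simp add: gauge_def)
  ultimately show "\<exists>\<gamma>. gauge \<gamma> \<and> (\<forall>p. p tagged_division_of {a..b} \<and> \<gamma> fine p
      \<longrightarrow> norm ((\<Sum>(x, K)\<in>p. Henstock_Kurzweil_Integration.content K *\<^sub>R f x) - y) < e)" by (intro exI conjI)
qed

lemma has_riemann_integral_unique: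
  "has_riemann_integral f y a b \<Longrightarrow> has_riemann_integral f z a b \<Longrightarrow> y = z"
  by (rule has_integral_unique; rule has_riemann_integral_imp_has_integral)

lemma riemann_integral_has_integral:
  assumes "riemann_integrable f a b"
  shows "(f has_integral riemann_integral f a b) {a..b}"
proof -
  obtain y where y: "has_riemann_integral f y a b"
    using assms unfolding riemann_integrable_def by blast
  then have "riemann_integral f a b = y"
    unfolding riemann_integral_def
    by (rule the_equality) (rule has_riemann_integral_unique[OF _ y])
  with y show ?thesis by (simp add: has_riemann_integral_imp_has_integral)
qed

definition riemann_integrable_mat :: "nat \<Rightarrow> (real \<Rightarrow> real mat) \<Rightarrow> real \<Rightarrow> real \<Rightarrow> bool" where
  "riemann_integrable_mat n A a b \<longleftrightarrow>
     (\<forall>i<n. \<forall>j<n. riemann_integrable (\<lambda>t. A t $$ (i, j)) a b)"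

definition riemann_integral_mat :: "nat \<Rightarrow> (real \<Rightarrow> real mat) \<Rightarrow> real \<Rightarrow> real \<Rightarrow> real mat" where
  "riemann_integral_mat n A a b =
     Matrix.mat n n (\<lambda>(i, j). riemann_integral (\<lambda>t. A t $$ (i, j)) a b)"

end

theory Submission
  imports Defs
begin

text \<open>
  The integral lies strictly between \<open>G\<close> and \<open>H\<close> in the checkerboard order, and every such
  matrix \<open>B\<close> is totally positive, by induction on the order of its minors. If all minors of order
  \<open>k\<close> are positive strictly inside the interval, then there, by cofactor expansion, each contiguous
  minor of order \<open>k + 1\<close> is strictly monotone in the checkerboard order, increasing or decreasing
  according to the parity of its corner. Comparing along the segment from \<open>G\<close> (or, for odd corners,
  \<open>H\<close>) to \<open>B\<close>, it is larger at \<open>B\<close> than at the end point, where it is nonnegative. Fekete's criterion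
  passes from contiguous to arbitrary minors.
\<close>

section \<open>Minors, Laplace expansion and the Pluecker relation\<close>

text \<open>Rows and columns are selected by functions instead of sets: an index may repeat among
  the first \<open>k\<close>, which makes the minor vanish, and precomposing with
  \<open>insert_index q\<close> deletes position \<open>q\<close>.\<close>

definition minor :: "nat \<Rightarrow> (nat \<Rightarrow> nat \<Rightarrow> 'a::comm_ring_1) \<Rightarrow> (nat \<Rightarrow> nat) \<Rightarrow> (nat \<Rightarrow> nat) \<Rightarrow> 'a" where
  "minor k a r c = Determinant.det (Matrix.mat k k (\<lambda>(i, j). a (r i) (c j)))"

lemma minor_0 [simp]: "minor 0 a r c = 1"
  unfolding minor_def by (rule det_dim_zero) simp

lemma minor_cong:
  assumes "\<And>i j. i < k \<Longrightarrow> j < k \<Longrightarrow> a (r i) (c j) = a' (r' i) (c' j)"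
  shows "minor k a r c = minor k a' r' c'"
  unfolding minor_def by (rule arg_cong[where f = Determinant.det]) (rule eq_matI, auto simp: assms)

lemma minor_transpose: "minor k (\<lambda>i j. a j i) c r = minor k a r c"
proof -
  have "Matrix.mat k k (\<lambda>(i, j). a (r j) (c i)) = transpose_mat (Matrix.mat k k (\<lambda>(i, j). a (r i) (c j)))"
    by (rule eq_matI) auto
  then show ?thesis
    unfolding minor_def by (simp add: det_transpose[of _ k])
qed

lemma minor_laplace_row:
  assumes "q < Suc k"
  shows "minor (Suc k) a r c =
    (\<Sum>j<Suc k. (-1) ^ (q + j) * a (r q) (c j) * minor k a (r \<circ> insert_index q) (c \<circ> insert_index j))"
proof -
  let ?M = "Matrix.mat (Suc k) (Suc k) (\<lambda>(i, j). a (r i) (c j))"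
  have "Determinant.det ?M = (\<Sum>j<Suc k. ?M $$ (q, j) * cofactor ?M q j)"
    by (rule laplace_expansion_row) (use assms in auto)
  also have "\<dots> = (\<Sum>j<Suc k. (-1) ^ (q + j) * a (r q) (c j) * minor k a (r \<circ> insert_index q) (c \<circ> insert_index j))"
  proof (rule sum.cong[OF refl])
    fix j assume "j \<in> {..<Suc k}"
    moreover have "mat_delete ?M q j = Matrix.mat k k (\<lambda>(i, l). a ((r \<circ> insert_index q) i) ((c \<circ> insert_index j) l))"
      unfolding mat_delete_def by (rule eq_matI) (auto simp: insert_index_def)
    ultimately show "?M $$ (q, j) * cofactor ?M q j =
        (-1) ^ (q + j) * a (r q) (c j) * minor k a (r \<circ> insert_index q) (c \<circ> insert_index j)"
      using assms unfolding cofactor_def minor_def by simp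
  qed
  finally show ?thesis
    unfolding minor_def .
qed

lemma minor_laplace_column:
  assumes "q < Suc k"
  shows "minor (Suc k) a r c =
    (\<Sum>i<Suc k. (-1) ^ (i + q) * a (r i) (c q) * minor k a (r \<circ> insert_index i) (c \<circ> insert_index q))"
  using minor_laplace_row[OF assms, of "\<lambda>i j. a j i" c r]
  by (simp only: minor_transpose[of _ a] add.commute)

lemma minor_eq_rows:
  assumes "i < k" "j < k" "i \<noteq> j" "r i = r j"
  shows "minor k a r c = 0"
  unfolding minor_def
  by (rule det_identical_rows[OF _ assms(3,1,2)]) (use assms in \<open>auto intro!: eq_vecI\<close>)

lemma minor_eq_columns:
  assumes "i < k" "j < k" "i \<noteq> j" "c i = c j"
  shows "minor k a r c = 0"
  using minor_eq_rows[OF assms, of "\<lambda>i j. a j i" r] by (simp only: minor_transpose[of _ a])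

text \<open>
  The three-term Pluecker relation. Here \<open>D i\<close> is the minor omitting the row \<open>r i\<close>; Cramer's rule says
  that the signed \<open>D i\<close> are the coefficients of a linear relation between the rows. The linear
  functional \<open>L\<close>, which is the bordered minor of the rows other than \<open>0\<close>, \<open>q\<close> and \<open>k + 1\<close>, is
  applied to this relation and kills all but three of its terms.
\<close>

lemma minor_plucker:
  fixes a :: "nat \<Rightarrow> nat \<Rightarrow> 'a::comm_ring_1"
  assumes q: "0 < q" "q \<le> k"
  shows "minor (Suc k) a (r \<circ> insert_index q) c * minor k a (r \<circ> Suc) c =
    minor (Suc k) a (r \<circ> Suc) c * minor k a (r \<circ> insert_index q) c +
    minor (Suc k) a r c * minor k a (r \<circ> insert_index q \<circ> Suc) c"
proof -
  from q obtain l where k: "k = Suc l"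
    by (cases k) auto
  define D where "D i = minor (Suc k) a (r \<circ> insert_index i) c" for i
  \<comment> \<open>The rows \<open>r 1\<close>, ..., \<open>r k\<close> without \<open>r q\<close>.
    After \<open>Suc\<close> has dropped row 0, row \<open>q\<close> stands at position
    \<open>q - 1\<close>.\<close>
  define K where "K = r \<circ> Suc \<circ> insert_index (q - 1)"
  define L where "L i = (\<Sum>j<k. (-1) ^ j * a (r i) (c j) * minor l a K (c \<circ> insert_index j))" for i
  have rel: "(\<Sum>i<Suc (Suc k). (-1) ^ i * D i * a (r i) (c j)) = 0" if j: "j < k" for j
  proof -
    \<comment> \<open>The added last column repeats \<open>c j\<close>, so the bordered minor
      vanishes; expanding it along that column gives the relation.\<close>
    define c' where "c' = c(Suc k := c j)"
    have c': "c' (Suc k) = c j"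
      by (simp add: c'_def)
    have D: "minor (Suc k) a (r \<circ> insert_index i) (c' \<circ> insert_index (Suc k)) = D i" for i
      unfolding D_def c'_def by (rule minor_cong) auto
    have "0 = (-1) ^ Suc k * minor (Suc (Suc k)) a r c'"
      using j by (subst minor_eq_columns[of "Suc k" _ j]) (auto simp: c'_def)
    also have "\<dots> = (-1) ^ Suc k * (\<Sum>i<Suc (Suc k). (-1) ^ (i + Suc k) * a (r i) (c j) * D i)"
      by (subst minor_laplace_column[of "Suc k"]) (simp_all add: D c' del: sum.lessThan_Suc)
    also have "\<dots> = (\<Sum>i<Suc (Suc k). (-1) ^ i * D i * a (r i) (c j))"
      unfolding sum_distrib_left
      by (rule sum.cong) (auto simp: power_add mult_ac simp flip: power_mult_distrib)
    finally show ?thesis by simp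
  qed
  have "(\<Sum>i<Suc (Suc k). (-1) ^ i * D i * L i) =
      (\<Sum>j<k. (-1) ^ j * minor l a K (c \<circ> insert_index j) * (\<Sum>i<Suc (Suc k). (-1) ^ i * D i * a (r i) (c j)))"
    unfolding L_def sum_distrib_left by (subst sum.swap) (simp add: mult_ac)
  also have "\<dots> = 0"
    by (rule sum.neutral) (auto simp: rel simp del: sum.lessThan_Suc)
  finally have sum0: "(\<Sum>i<Suc (Suc k). (-1) ^ i * D i * L i) = 0" .
  \<comment> \<open>Up to the sign belonging to position \<open>s\<close>, \<open>L i\<close> is the
    minor whose rows are \<open>K\<close> with \<open>r i\<close> inserted at
    \<open>s\<close>.\<close>
  have L: "minor k a f c = (-1) ^ s * L i"
    if s: "s < k" and f: "f s = r i" "\<And>x. x < l \<Longrightarrow> f (insert_index s x) = K x" for f s i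
  proof -
    have "minor l a (f \<circ> insert_index s) (c \<circ> insert_index j) = minor l a K (c \<circ> insert_index j)" for j
      by (rule minor_cong) (use f in auto)
    then show ?thesis
      using s unfolding k L_def
      by (subst minor_laplace_row[of s]) (simp_all add: f power_add sum_distrib_left mult_ac del: sum.lessThan_Suc)
  qed
  have L0: "L i = 0" if i: "i < Suc (Suc k)" "i \<noteq> 0" "i \<noteq> q" "i \<noteq> Suc k" for i
  proof -
    \<comment> \<open>The position of row \<open>r i\<close> in \<open>K\<close>: row 0 is missing
      there, and past \<open>q\<close> row \<open>q\<close> is missing too. Hence \<open>f\<close>
      below contains this row twice.\<close>
    define x where "x = (if i < q then i - 1 else i - 2)"
    have x: "x < l" "K x = r i"
      using i q k by (auto simp: x_def K_def insert_index_def intro!: arg_cong[where f = r])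
    define f where "f = case_nat (r i) K"
    have "minor k a f c = (-1) ^ 0 * L i"
      by (rule L) (auto simp: f_def k)
    moreover have "minor k a f c = 0"
      by (rule minor_eq_rows[of 0 _ "Suc x"]) (use x k in \<open>auto simp: f_def\<close>)
    ultimately show ?thesis by simp
  qed
  \<comment> \<open>In the three surviving terms the row added to \<open>K\<close> sits at position
    0, \<open>q - 1\<close> and \<open>l\<close> respectively.\<close>
  have E0: "minor k a (r \<circ> insert_index q) c = (-1) ^ 0 * L 0"
    by (rule L) (use q k in \<open>auto simp: K_def insert_index_def intro!: arg_cong[where f = r]\<close>)
  have Eq: "minor k a (r \<circ> Suc) c = (-1) ^ (q - 1) * L q"
    by (rule L) (use q k in \<open>auto simp: K_def\<close>)
  have El: "minor k a (r \<circ> insert_index q \<circ> Suc) c = (-1) ^ l * L (Suc k)"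
    by (rule L) (use q k in \<open>auto simp: K_def insert_index_def intro!: arg_cong[where f = r]\<close>)
  have D0: "minor (Suc k) a (r \<circ> Suc) c = D 0"
    unfolding D_def by (rule minor_cong) auto
  have Dl: "minor (Suc k) a r c = D (Suc k)"
    unfolding D_def by (rule minor_cong) auto
  have "(\<Sum>i\<in>{0, q, Suc k}. (-1) ^ i * D i * L i) = (\<Sum>i<Suc (Suc k). (-1) ^ i * D i * L i)"
    by (rule sum.mono_neutral_left) (use q L0 in auto)
  with sum0 q have "D 0 * L 0 + ((-1) ^ q * D q * L q + (-1) ^ Suc k * D (Suc k) * L (Suc k)) = 0"
    by (simp del: sum.lessThan_Suc power_Suc)
  moreover have "(-1) ^ q = - ((-1) ^ (q - 1) :: 'a)"
    using q by (cases q) auto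
  ultimately show ?thesis
    unfolding E0 Eq El D0 Dl D_def[of q, symmetric] by (simp add: k algebra_simps)
qed

section \<open>Increasing index sequences and Fekete's criterion\<close>

text \<open>Only arguments below \<open>k\<close> are constrained, since \<open>pick I\<close> is
  unspecified from \<open>card I\<close> on.\<close>

definition index_seq :: "nat \<Rightarrow> nat \<Rightarrow> (nat \<Rightarrow> nat) \<Rightarrow> bool" where
  "index_seq k n r \<longleftrightarrow> strict_mono_on {..<k} r \<and> (\<forall>i<k. r i < n)"

lemma index_seq_comp:
  "index_seq k n r \<Longrightarrow> index_seq l k f \<Longrightarrow> index_seq l n (r \<circ> f)"
  unfolding index_seq_def strict_mono_on_def by auto

lemma index_seq_insert_index: "index_seq k (Suc k) (insert_index q)"
  unfolding index_seq_def strict_mono_on_def insert_index_def by auto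

lemma index_seq_Suc: "index_seq k (Suc k) Suc"
  unfolding index_seq_def strict_mono_on_def by auto

lemma index_seq_le: "index_seq k n r \<Longrightarrow> l \<le> k \<Longrightarrow> index_seq l n r"
  unfolding index_seq_def strict_mono_on_def by auto

lemma index_seq_shift: "p + k \<le> n \<Longrightarrow> index_seq k n ((+) p)"
  unfolding index_seq_def strict_mono_on_def by auto

text \<open>Each step is at least 1; if no step exceeded 1, induction would make the sequence
  contiguous.\<close>

lemma index_seq_gap:
  assumes "index_seq (Suc k) n r" and "\<exists>i<Suc k. r i \<noteq> r 0 + i"
  obtains q where "q < k" "Suc (r q) < r (Suc q)"
proof -
  have "\<exists>q<k. Suc (r q) < r (Suc q)"
  proof (rule ccontr)
    assume no: "\<not> ?thesis"
    have "r i = r 0 + i" if "i < Suc k" for i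
      using that
    proof (induction i)
      case (Suc i)
      then have "r i < r (Suc i)"
        using assms(1) strict_mono_onD[of "{..<Suc k}" r i "Suc i"] unfolding index_seq_def by simp
      moreover have "\<not> Suc (r i) < r (Suc i)"
        using no Suc.prems by auto
      ultimately show ?case
        using Suc by auto
    qed simp
    with assms(2) show False by blast
  qed
  with that show ?thesis by blast
qed

text \<open>
  Fekete's criterion, by induction on the spread of the rows: filling a gap of \<open>r\<close> gives a sequence
  \<open>R\<close> whose Pluecker relation expresses the minor with rows \<open>r\<close> by minors of smaller spread.
\<close>

lemma fekete_rows:
  fixes a :: "nat \<Rightarrow> nat \<Rightarrow> 'a::linordered_idom"
  assumes sub: "\<And>r. index_seq k n r \<Longrightarrow> 0 < minor k a r c"
    and contiguous: "\<And>p. p + Suc k \<le> n \<Longrightarrow> 0 < minor (Suc k) a ((+) p) c"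
    and "index_seq (Suc k) n r"
  shows "0 < minor (Suc k) a r c"
  using assms(3)
proof (induction "r k - r 0" arbitrary: r rule: less_induct)
  case less
  show ?case
  proof (cases "\<exists>i<Suc k. r i \<noteq> r 0 + i")
    case False
    then have r: "r 0 + i = r i" if "i < Suc k" for i
      using that by metis
    have "minor (Suc k) a r c = minor (Suc k) a ((+) (r 0)) c"
      by (intro minor_cong) (simp add: r)
    moreover have "r 0 + Suc k \<le> n"
      using r[of k] less.prems unfolding index_seq_def by (metis add_Suc_right lessI Suc_leI)
    ultimately show ?thesis
      using contiguous by simp
  next
    case True
    with less.prems obtain q where q: "q < k" "Suc (r q) < r (Suc q)"
      by (rule index_seq_gap)
    \<comment> \<open>Inserts \<open>Suc (r q)\<close> into the gap at position
      \<open>Suc q\<close>; deleting that position recovers \<open>r\<close>.\<close>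
    define R where "R i = (if i \<le> q then r i else if i = Suc q then Suc (r q) else r (i - 1))" for i
    have mono: "r i < r j" if "i < j" "j \<le> k" for i j
      using less.prems that strict_mono_onD[of "{..<Suc k}" r i j] unfolding index_seq_def by simp
    have bound: "r i < n" if "i \<le> k" for i
      using less.prems that unfolding index_seq_def by simp
    have RSuc: "R i < R (Suc i)" if "i \<le> k" for i
      using that q mono[of i "Suc i"] mono[of "i - 1" i] unfolding R_def
      by (auto simp: not_le le_Suc_eq)
    have R: "index_seq (Suc (Suc k)) n R"
      unfolding index_seq_def
    proof (intro conjI allI impI strict_mono_onI)
      fix i assume "i < Suc (Suc k)"
      then show "R i < n"
        using q less_trans[OF q(2) bound[of "Suc q"]] bound[of i] bound[of "i - 1"] unfolding R_def by auto
    next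
      fix i j assume "i \<in> {..<Suc (Suc k)}" "j \<in> {..<Suc (Suc k)}" "i < j"
      then show "R i < R j"
      proof (induction j)
        case (Suc j)
        then show ?case
          using RSuc[of j] by (cases "i = j") auto
      qed simp
    qed
    have r: "R \<circ> insert_index (Suc q) = r"
      using q by (auto simp: R_def insert_index_def fun_eq_iff)
    \<comment> \<open>Dropping the first row \<open>r 0\<close> of \<open>R\<close> keeps the last
      row \<open>r k\<close> and raises the first, so the spread shrinks.\<close>
    have 1: "0 < minor (Suc k) a (R \<circ> Suc) c"
    proof (rule less.hyps)
      show "index_seq (Suc k) n (R \<circ> Suc)"
        by (rule index_seq_comp[OF R index_seq_Suc])
      show "(R \<circ> Suc) k - (R \<circ> Suc) 0 < r k - r 0"
        using q RSuc[of 0] mono[of 0 k] unfolding R_def by (auto split: if_splits)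
    qed
    \<comment> \<open>The first \<open>Suc k\<close> rows of \<open>R\<close> omit the last row
      \<open>r k\<close>, which shrinks the spread from above.\<close>
    have 2: "0 < minor (Suc k) a R c"
    proof (rule less.hyps)
      show "index_seq (Suc k) n R"
        by (rule index_seq_le[OF R]) simp
      show "R k - R 0 < r k - r 0"
        using q RSuc[of k] mono[of 0 k] unfolding R_def by (auto split: if_splits)
    qed
    have 3: "0 < minor k a (R \<circ> Suc) c" "0 < minor k a r c" "0 < minor k a (r \<circ> Suc) c"
      by (rule sub index_seq_comp[OF _ index_seq_Suc] index_seq_le[OF R] index_seq_le[OF less.prems] less.prems | simp)+
    have "minor (Suc k) a r c * minor k a (R \<circ> Suc) c =
      minor (Suc k) a (R \<circ> Suc) c * minor k a r c + minor (Suc k) a R c * minor k a (r \<circ> Suc) c"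
      using minor_plucker[of "Suc q" k a R c] q by (simp only: r)
    with 1 2 3 have "0 < minor (Suc k) a r c * minor k a (R \<circ> Suc) c"
      by (simp add: add_pos_pos)
    with 3(1) show ?thesis
      by (simp add: zero_less_mult_iff)
  qed
qed

text \<open>\<open>fekete_rows\<close> is applied twice: first to rows with contiguous columns
  fixed, then, by transposition, to columns with the arbitrary rows \<open>r\<close> fixed.\<close>

theorem fekete:
  fixes a :: "nat \<Rightarrow> nat \<Rightarrow> 'a::linordered_idom"
  assumes sub: "\<And>r c. index_seq k n r \<Longrightarrow> index_seq k m c \<Longrightarrow> 0 < minor k a r c"
    and contiguous: "\<And>p q. p + Suc k \<le> n \<Longrightarrow> q + Suc k \<le> m \<Longrightarrow> 0 < minor (Suc k) a ((+) p) ((+) q)"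
    and r: "index_seq (Suc k) n r" and c: "index_seq (Suc k) m c"
  shows "0 < minor (Suc k) a r c"
proof -
  have "0 < minor (Suc k) (\<lambda>i j. a j i) c r"
  proof (rule fekete_rows[OF _ _ c])
    show "0 < minor k (\<lambda>i j. a j i) c' r" if "index_seq k m c'" for c'
      using sub[OF index_seq_le[OF r] that] by (simp only: minor_transpose[of _ a])
    show "0 < minor (Suc k) (\<lambda>i j. a j i) ((+) q) r" if q: "q + Suc k \<le> m" for q
    proof -
      have "0 < minor (Suc k) a r ((+) q)"
        by (rule fekete_rows[OF _ _ r]) (use sub contiguous q index_seq_shift[of q k m] in auto)
      then show ?thesis by (simp only: minor_transpose[of _ a])
    qed
  qed
  then show ?thesis by (simp only: minor_transpose[of _ a])
qed

section \<open>Monotonicity in the checkerboard order\<close>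

text \<open>The rows of \<open>a\<close> are replaced by those of \<open>b\<close> one at a time. In
  the expansion along the replaced row, the cofactor signs match the signs of the entry increments,
  and the complementary minors are positive. The signs refer to positions within the minor, not
  within the matrix.\<close>

lemma minor_checkerboard_strict_mono:
  fixes a b :: "nat \<Rightarrow> nat \<Rightarrow> 'a::linordered_idom"
  assumes less: "\<And>i j. i < Suc k \<Longrightarrow> j < Suc k \<Longrightarrow>
      (-1) ^ (i + j) * a (p + i) (c j) < (-1) ^ (i + j) * b (p + i) (c j)"
    and pos: "\<And>i j. i < Suc k \<Longrightarrow> j < Suc k \<Longrightarrow>
      0 < minor k (\<lambda>x. if x < p + i then b x else a x) ((+) p \<circ> insert_index i) (c \<circ> insert_index j)"
  shows "minor (Suc k) a ((+) p) c < minor (Suc k) b ((+) p) c"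
proof -
  define N where "N q = (\<lambda>x. if x < p + q then b x else a x)" for q
  define f where "f q = minor (Suc k) (N q) ((+) p) c" for q
  have step: "f q < f (Suc q)" if q: "q < Suc k" for q
  proof -
    \<comment> \<open>The two mixtures differ only in row \<open>p + q\<close>, which these minors
      omit.\<close>
    have *: "minor k (N (Suc q)) ((+) p \<circ> insert_index q) (c \<circ> insert_index j) =
        minor k (N q) ((+) p \<circ> insert_index q) (c \<circ> insert_index j)" for j
      by (rule minor_cong) (auto simp: N_def insert_index_def)
    show ?thesis
      unfolding f_def minor_laplace_row[OF q] *
    proof (rule sum_strict_mono)
      fix j assume j: "j \<in> {..<Suc k}"
      show "(-1) ^ (q + j) * N q (p + q) (c j) * minor k (N q) ((+) p \<circ> insert_index q) (c \<circ> insert_index j) <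
          (-1) ^ (q + j) * N (Suc q) (p + q) (c j) * minor k (N q) ((+) p \<circ> insert_index q) (c \<circ> insert_index j)"
        by (rule mult_strict_right_mono) (use j q less[of q j] pos[of q j] in \<open>auto simp: N_def\<close>)
    qed auto
  qed
  have "f 0 < f (Suc q)" if "q \<le> k" for q
    using that
  proof (induction q)
    case (Suc q)
    then show ?case
      using step[of "Suc q"] by auto
  qed (use step[of 0] in simp)
  then have "f 0 < f (Suc k)" by simp
  moreover have "f 0 = minor (Suc k) a ((+) p) c"
    unfolding f_def N_def by (rule minor_cong) simp
  moreover have "f (Suc k) = minor (Suc k) b ((+) p) c"
    unfolding f_def N_def by (rule minor_cong) simp
  ultimately show ?thesis by simp
qed

definition checkerboard_less :: "nat \<Rightarrow> (nat \<Rightarrow> nat \<Rightarrow> real) \<Rightarrow> (nat \<Rightarrow> nat \<Rightarrow> real) \<Rightarrow> bool" where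
  "checkerboard_less n a b \<longleftrightarrow> (\<forall>i<n. \<forall>j<n. (-1) ^ (i + j) * a i j < (-1) ^ (i + j) * b i j)"

lemma continuous_minor:
  fixes a :: "'b::topological_space \<Rightarrow> nat \<Rightarrow> nat \<Rightarrow> real"
  assumes "\<And>i j. continuous_on S (\<lambda>e. a e i j)"
  shows "continuous_on S (\<lambda>e. minor k (a e) r c)"
proof -
  have "minor k (a e) r c = (\<Sum>p | p permutes {0..<k}. signof p * (\<Prod>i = 0..<k. a e (r i) (c (p i))))" for e
    unfolding minor_def
    by (subst det_def'[of _ k]) (auto intro!: sum.cong prod.cong simp: permutes_in_image)
  then show ?thesis
    by (simp only:) (intro continuous_intros assms)
qed

text \<open>The hypothesis \<open>IH\<close> covers only matrices strictly inside the interval, so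
  strict monotonicity is shown for positive parameters of the segment and extended to its end point
  by continuity.\<close>

lemma contiguous_minor_pos:
  assumes gb: "checkerboard_less n g b" and bh: "checkerboard_less n b h"
    and IH: "\<And>b r c. checkerboard_less n g b \<Longrightarrow> checkerboard_less n b h \<Longrightarrow>
      index_seq k n r \<Longrightarrow> index_seq k n c \<Longrightarrow> 0 < minor k b r c"
    and p: "p + Suc k \<le> n" and q: "q + Suc k \<le> n"
    and nonneg: "0 \<le> minor (Suc k) g ((+) p) ((+) q)" "0 \<le> minor (Suc k) h ((+) p) ((+) q)"
  shows "0 < minor (Suc k) b ((+) p) ((+) q)"
proof -
  \<comment> \<open>Passing from matrix indices to positions in the minor changes the checkerboard
    sign by \<open>(-1) ^ (p + q)\<close>. With this choice of end point, the minor increases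
    towards \<open>b\<close> for either parity.\<close>
  define x where "x = (if even (p + q) then g else h)"
  define y where "y e i j = x i j + e * (b i j - x i j)" for e :: real and i j
  let ?m = "\<lambda>a. minor (Suc k) a ((+) p) ((+) q)"
  have inside: "checkerboard_less n g (y e)" "checkerboard_less n (y e) h" if e: "0 < e" "e \<le> 1" for e
  proof -
    have "(-1) ^ (i + j) * g i j < (-1) ^ (i + j) * y e i j \<and> (-1) ^ (i + j) * y e i j < (-1) ^ (i + j) * h i j"
      if "i < n" "j < n" for i j
    proof -
      define s :: real where "s = (-1) ^ (i + j)"
      have s: "s * g i j < s * b i j" "s * b i j < s * h i j"
        using gb bh that unfolding checkerboard_less_def s_def by auto
      have eq: "s * y e i j = s * x i j + e * (s * b i j - s * x i j)"
        by (simp add: y_def algebra_simps)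
      have convex: "0 < e * z \<and> e * z \<le> z" if "0 < z" for z
        using e that by (simp add: mult_left_le_one_le)
      show ?thesis
      proof (cases "even (p + q)")
        case True
        then have x: "x = g" by (simp add: x_def)
        have "0 < e * (s * b i j - s * g i j) \<and> e * (s * b i j - s * g i j) \<le> s * b i j - s * g i j"
          by (rule convex) (use s in simp)
        then show ?thesis
          using s eq unfolding s_def[symmetric] x by linarith
      next
        case False
        then have x: "x = h" by (auto simp: x_def)
        have "0 < e * (s * h i j - s * b i j) \<and> e * (s * h i j - s * b i j) \<le> s * h i j - s * b i j"
          by (rule convex) (use s in simp)
        moreover have "e * (s * b i j - s * h i j) = - (e * (s * h i j - s * b i j))"
          by (simp add: algebra_simps)
        ultimately show ?thesis
          using s eq unfolding s_def[symmetric] x by linarith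
      qed
    qed
    then show "checkerboard_less n g (y e)" "checkerboard_less n (y e) h"
      unfolding checkerboard_less_def by auto
  qed
  have sgn: "0 < (-1) ^ (i + j) * (b (p + i) (q + j) - x (p + i) (q + j))" if "i < Suc k" "j < Suc k" for i j
  proof -
    have "p + i < n" "q + j < n"
      using that p q by auto
    then have "0 < (-1) ^ (p + i + (q + j)) * (b (p + i) (q + j) - g (p + i) (q + j))"
      "(-1) ^ (p + i + (q + j)) * (b (p + i) (q + j) - h (p + i) (q + j)) < 0"
      using gb bh unfolding checkerboard_less_def by (auto simp: right_diff_distrib)
    then show ?thesis
      by (cases "even (p + q)"; cases "even (i + j)") (auto simp: x_def)
  qed
  have mono: "?m (y d) < ?m (y e)" if de: "0 < d" "d < e" "e \<le> 1" for d e
  proof (rule minor_checkerboard_strict_mono)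
    fix i j assume ij: "i < Suc k" "j < Suc k"
    have "0 < (e - d) * ((-1) ^ (i + j) * (b (p + i) (q + j) - x (p + i) (q + j)))"
      by (rule mult_pos_pos[OF _ sgn[OF ij]]) (use de in simp)
    then show "(-1) ^ (i + j) * y d (p + i) (q + j) < (-1) ^ (i + j) * y e (p + i) (q + j)"
      by (simp add: y_def algebra_simps)
    show "0 < minor k (\<lambda>x. if x < p + i then y e x else y d x) ((+) p \<circ> insert_index i) ((+) q \<circ> insert_index j)"
    \<comment> \<open>The checkerboard order is entrywise, so mixing rows of two matrices inside the
      interval stays inside.\<close>
    proof (rule IH)
      show "checkerboard_less n g (\<lambda>x. if x < p + i then y e x else y d x)"
        "checkerboard_less n (\<lambda>x. if x < p + i then y e x else y d x) h"
        using inside[of d] inside[of e] de unfolding checkerboard_less_def by auto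
    qed (use index_seq_comp[OF index_seq_shift index_seq_insert_index] p q in auto)
  qed
  have "continuous_on UNIV (\<lambda>e. ?m (y e))"
    by (rule continuous_minor) (unfold y_def, intro continuous_intros)
  then have "((\<lambda>e. ?m (y e)) \<longlongrightarrow> ?m (y 0)) (at_right 0)"
    by (simp add: continuous_on_eq_continuous_at isCont_def filterlim_at_split)
  \<comment> \<open>The limit at 0 only yields a weak inequality; the intermediate parameter
    \<open>1/2\<close> leaves a strict one up to 1.\<close>
  moreover have "eventually (\<lambda>e. ?m (y e) \<le> ?m (y (1/2))) (at_right 0)"
    using mono[of _ "1/2"] unfolding eventually_at_right_field
    by (intro exI[of _ "1/2"]) (auto intro: less_imp_le)
  ultimately have "?m (y 0) \<le> ?m (y (1/2))"
    by (intro tendsto_upperbound[where F = "at_right 0"]) auto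
  also have "\<dots> < ?m (y 1)"
    by (rule mono) auto
  finally have "?m (y 0) < ?m (y 1)" .
  moreover have "y 0 = x" "y 1 = b"
    by (simp_all add: y_def fun_eq_iff)
  moreover have "0 \<le> ?m x"
    using nonneg by (simp add: x_def)
  ultimately show ?thesis by simp
qed

text \<open>The induction on \<open>k\<close> keeps \<open>b\<close> arbitrary: the contiguous step
  uses order-\<open>k\<close> minors of other matrices in the interval, Fekete's criterion those of
  \<open>b\<close> itself.\<close>

theorem checkerboard_interval_minor_pos:
  assumes nonneg: "\<And>k p q. p + k \<le> n \<Longrightarrow> q + k \<le> n \<Longrightarrow>
      0 \<le> minor k g ((+) p) ((+) q) \<and> 0 \<le> minor k h ((+) p) ((+) q)"
  shows "checkerboard_less n g b \<Longrightarrow> checkerboard_less n b h \<Longrightarrow>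
    index_seq k n r \<Longrightarrow> index_seq k n c \<Longrightarrow> 0 < minor k b r c"
proof (induction k arbitrary: b r c)
  case (Suc k)
  show ?case
  proof (rule fekete[OF _ _ Suc.prems(3,4)])
    show "0 < minor k b r' c'" if "index_seq k n r'" "index_seq k n c'" for r' c'
      using Suc.IH Suc.prems that by blast
    show "0 < minor (Suc k) b ((+) p) ((+) q)" if "p + Suc k \<le> n" "q + Suc k \<le> n" for p q
      using contiguous_minor_pos[OF Suc.prems(1,2) Suc.IH that] nonneg[OF that] by blast
  qed
qed simp

section \<open>Submatrices as index sequences, and the integral matrix\<close>

lemma det_submatrix:
  assumes "I \<subseteq> {..<dim_row A}" "J \<subseteq> {..<dim_col A}" "card I = card J"
  shows "Determinant.det (submatrix A I J) = minor (card I) (\<lambda>i j. A $$ (i, j)) (pick I) (pick J)"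
proof -
  have "{i. i < dim_row A \<and> i \<in> I} = I" "{j. j < dim_col A \<and> j \<in> J} = J"
    using assms by auto
  then show ?thesis
    unfolding submatrix_def minor_def using assms(3) by simp
qed

lemma pick_atLeastLessThan: "i < k \<Longrightarrow> pick {p..<p + k} i = p + i"
proof (induction i)
  case (Suc i)
  then show ?case
    by (auto intro!: Least_equality)
qed (auto intro!: Least_equality)

lemma totally_nonnegative_contiguous_minor:
  assumes "totally_nonnegative A" "A \<in> carrier_mat n m" "p + k \<le> n" "q + k \<le> m"
  shows "0 \<le> minor k (\<lambda>i j. A $$ (i, j)) ((+) p) ((+) q)"
\<comment> \<open>\<open>totally_nonnegative\<close> speaks of nonempty index sets only; the minor
  of order 0 is 1.\<close>
proof (cases "k = 0")
  case False
  let ?I = "{p..<p + k}" and ?J = "{q..<q + k}"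
  have IJ: "?I \<noteq> {}" "?I \<subseteq> {..<dim_row A}" "?J \<subseteq> {..<dim_col A}" "card ?I = card ?J"
    using assms False by auto
  then have "0 \<le> Determinant.det (submatrix A ?I ?J)"
    using assms(1) unfolding totally_nonnegative_def by blast
  also have "\<dots> = minor k (\<lambda>i j. A $$ (i, j)) ((+) p) ((+) q)"
    unfolding det_submatrix[OF IJ(2-4)] by (simp, rule minor_cong) (simp add: pick_atLeastLessThan)
  finally show ?thesis .
qed simp

lemma index_seq_pick:
  assumes "I \<subseteq> {..<n}"
  shows "index_seq (card I) n (pick I)"
  using assms pick_mono_le[of _ I] pick_in_set_le[of _ I]
  unfolding index_seq_def strict_mono_on_def by auto

theorem theorem4:
  fixes n :: nat and A :: "real \<Rightarrow> real mat"
  assumes "\<And>t. t \<in> {0..1} \<Longrightarrow> A t \<in> carrier_mat n n"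
    and "riemann_integrable_mat n A 0 1"
    and "\<exists>\<delta>>0. \<exists>G\<in>carrier_mat n n. \<exists>H\<in>carrier_mat n n.
           totally_nonnegative G \<and> totally_nonnegative H \<and>
           (\<forall>i<n. \<forall>j<n. \<forall>t\<in>{0..1}.
              \<delta> + (-1) ^ (i + j) * G $$ (i, j) \<le> (-1) ^ (i + j) * A t $$ (i, j) \<and>
              (-1) ^ (i + j) * A t $$ (i, j) \<le> - \<delta> + (-1) ^ (i + j) * H $$ (i, j))"
  shows "totally_positive (riemann_integral_mat n A 0 1)"
proof -
  obtain \<delta> G H where \<delta>: "\<delta> > 0" and G: "G \<in> carrier_mat n n" "totally_nonnegative G"
    and H: "H \<in> carrier_mat n n" "totally_nonnegative H"
    and bounds: "\<And>i j t. i < n \<Longrightarrow> j < n \<Longrightarrow> t \<in> {0..1} \<Longrightarrow>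
        \<delta> + (-1) ^ (i + j) * G $$ (i, j) \<le> (-1) ^ (i + j) * A t $$ (i, j) \<and>
        (-1) ^ (i + j) * A t $$ (i, j) \<le> - \<delta> + (-1) ^ (i + j) * H $$ (i, j)"
    using assms(3) by blast
  let ?B = "riemann_integral_mat n A 0 1"
  have dim: "dim_row ?B = n" "dim_col ?B = n"
    by (simp_all add: riemann_integral_mat_def)
  \<comment> \<open>The bounds are integrated over an interval of length 1, so constants are
    preserved; \<open>\<delta>\<close> makes the resulting inequalities strict.\<close>
  have B: "(-1) ^ (i + j) * G $$ (i, j) < (-1) ^ (i + j) * ?B $$ (i, j) \<and>
      (-1) ^ (i + j) * ?B $$ (i, j) < (-1) ^ (i + j) * H $$ (i, j)" if ij: "i < n" "j < n" for i j
  proof -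
    have const: "((\<lambda>t. c) has_integral c) {0..1::real}" for c :: real
      using has_integral_const_real[of c 0 1] by simp
    have "((\<lambda>t. A t $$ (i, j)) has_integral ?B $$ (i, j)) {0..1}"
      using assms(2) ij riemann_integral_has_integral
      unfolding riemann_integrable_mat_def riemann_integral_mat_def by simp
    then have "((\<lambda>t. (-1) ^ (i + j) * A t $$ (i, j)) has_integral (-1) ^ (i + j) * ?B $$ (i, j)) {0..1}"
      by (rule has_integral_mult_right)
    from has_integral_le[OF const this] has_integral_le[OF this const] bounds[OF ij]
    have "\<delta> + (-1) ^ (i + j) * G $$ (i, j) \<le> (-1) ^ (i + j) * ?B $$ (i, j)"
      "(-1) ^ (i + j) * ?B $$ (i, j) \<le> - \<delta> + (-1) ^ (i + j) * H $$ (i, j)"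
      by blast+
    with \<delta> show ?thesis by linarith
  qed
  show ?thesis
    unfolding totally_positive_def dim
  proof (intro allI impI, elim conjE)
    fix I J assume IJ: "I \<noteq> {}" "I \<subseteq> {..<n}" "J \<subseteq> {..<n}" "card I = card J"
    have "0 < minor (card I) (\<lambda>i j. ?B $$ (i, j)) (pick I) (pick J)"
    proof (rule checkerboard_interval_minor_pos)
      show "checkerboard_less n (\<lambda>i j. G $$ (i, j)) (\<lambda>i j. ?B $$ (i, j))"
        "checkerboard_less n (\<lambda>i j. ?B $$ (i, j)) (\<lambda>i j. H $$ (i, j))"
        using B unfolding checkerboard_less_def by auto
      show "index_seq (card I) n (pick I)" "index_seq (card I) n (pick J)"
        using index_seq_pick[OF IJ(2)] index_seq_pick[OF IJ(3)] IJ(4) by simp_all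
    qed (use totally_nonnegative_contiguous_minor G H in blast)
    then show "0 < Determinant.det (submatrix ?B I J)"
      using IJ by (simp add: det_submatrix dim)
  qed
qed

end
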